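(* Let $n\ge2$, let $q$ be a prime power and $\mathbb{V}_0=\mathbb{F}_q^n$. For every $\varphi\in Aut(\mathbf{SIG}(\mathbb{V}_0))$ we have $\varphi(\mathcal{E}^{n-1}(\mathbb{F}_q))=\mathcal{E}^{n-1}(\mathbb{F}_q)$ and $\varphi(\mathbb{P}^{n-1}(\mathbb{F}_q))=\mathbb{P}^{n-1}(\mathbb{F}_q)$.
   Context: $\mathbb{F}_q$ is the finite field with $q$ elements and $\mathbb{V}_0=\mathbb{F}_q^n$ is the space of column vectors. $E_n(\mathbb{F}_q)$ is the set of nonzero matrices $M\in M_n(\mathbb{F}_q)$ having at least one eigenvector in $\mathbb{V}_0$ (a nonzero $v$ with $Mv=\lambda v$ for some $\lambda\in\mathbb{F}_q$; $\lambda=0$ allowed). $\mathcal{E}^{n-1}(\mathbb{F}_q)=\{\langle M\rangle: M\in E_n(\mathbb{F}_q)\}$ is the set of one-dimensional subspaces of $M_n(\mathbb{F}_q)$ generated by elements of $E_n(\mathbb{F}_q)$, and $\mathbb{P}^{n-1}(\mathbb{F}_q)$ is the set of one-dimensional subspaces $\langle v\rangle$ of $\mathbb{V}_0$. The spectral incidence graph $\mathbf{SIG}(\mathbb{V}_0)$ is the simple bipartite graph with vertex set the disjoint union $\mathcal{E}^{n-1}(\mathbb{F}_q)\cup\mathbb{P}^{n-1}(\mathbb{F}_q)$ in which $\langle M\rangle$ and $\langle v\rangle$ are adjacent iff $v$ is an eigenvector of $M$. $Aut$ of a graph is its group of graph automorphisms (permutations of the whole vertex set preserving adjacency in both directions).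 *)

theory Defs
  imports
    "HOL-Combinatorics.Permutations"
    "Graph_Theory.Pair_Digraph"
    "Jordan_Normal_Form.Char_Poly"
    "Jordan_Normal_Form.VS_Connect"
begin

text \<open>
  The field with \<open>q\<close> elements is a type \<open>'a :: {field, finite}\<close>, with \<open>q = CARD('a)\<close>;
  column vectors and square matrices over it are \<open>carrier_vec n\<close> and \<open>carrier_mat n n\<close>.
\<close>

abbreviation span_vec :: "nat \<Rightarrow> 'a::field vec set \<Rightarrow> 'a vec set" where
  "span_vec n S \<equiv> LinearCombinations.module.span class_ring (module_vec TYPE('a) n) S"

abbreviation span_mat :: "nat \<Rightarrow> 'a::field mat set \<Rightarrow> 'a mat set" where
  "span_mat n S \<equiv> LinearCombinations.module.span class_ring (module_mat TYPE('a) n n) S"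

definition E_mats :: "nat \<Rightarrow> 'a::field mat set" where
  "E_mats n = {M \<in> carrier_mat n n. M \<noteq> 0\<^sub>m n n \<and> (\<exists>v k. eigenvector M v k)}"

definition E_lines :: "nat \<Rightarrow> 'a::field mat set set" where
  "E_lines n = {span_mat n {M} | M. M \<in> E_mats n}"

definition P_lines :: "nat \<Rightarrow> 'a::field vec set set" where
  "P_lines n = {span_vec n {v} | v. v \<in> carrier_vec n \<and> v \<noteq> 0\<^sub>v n}"

text \<open>
  An undirected graph is a symmetric \<open>pair_pre_digraph\<close>, each edge being present in both
  directions. The two vertex classes are the \<open>Inl\<close> and the \<open>Inr\<close> part of a sum type. Adjacency
  does not depend on the choice of generators, see \<open>SIG_adjacent_iff\<close> below.
\<close>

type_synonym 'a sig_vertex = "'a mat set + 'a vec set"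

definition SIG_edges :: "nat \<Rightarrow> 'a::field sig_vertex rel" where
  "SIG_edges n = {(Inl (span_mat n {M}), Inr (span_vec n {v})) | M v.
                    M \<in> E_mats n \<and> (\<exists>k. eigenvector M v k)}"

definition SIG :: "nat \<Rightarrow> 'a::field sig_vertex pair_pre_digraph" where
  "SIG n = \<lparr> pverts = E_lines n <+> P_lines n, parcs = SIG_edges n \<union> (SIG_edges n)\<inverse> \<rparr>"

text \<open>
  \<open>permutes\<close> makes an automorphism the identity outside the vertex set, so that each automorphism
  is represented by exactly one function.
\<close>

definition graph_Aut :: "'v pair_pre_digraph \<Rightarrow> ('v \<Rightarrow> 'v) set" where
  "graph_Aut G = {\<phi>. \<phi> permutes pverts G \<and>
     (\<forall>x\<in>pverts G. \<forall>y\<in>pverts G. (x, y) \<in> parcs G \<longleftrightarrow> (\<phi> x, \<phi> y) \<in> parcs G)}"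

lemma (in module) span_singleton:
  assumes "v \<in> carrier M"
  shows "span {v} = {a \<odot>\<^bsub>M\<^esub> v | a. a \<in> carrier R}"
proof -
  have lc: "lincomb a {v} = a v \<odot>\<^bsub>M\<^esub> v" if "a \<in> {v} \<rightarrow> carrier R" for a
    using that assms by (simp add: lincomb_def finsum_insert Pi_def)
  have "span {v} = {lincomb a {v} | a. a \<in> {v} \<rightarrow> carrier R}"
    using assms by (intro finite_span) auto
  also have "\<dots> = {a v \<odot>\<^bsub>M\<^esub> v | a. a \<in> {v} \<rightarrow> carrier R}"
    using lc by (intro Collect_cong) metis
  also have "\<dots> = {a \<odot>\<^bsub>M\<^esub> v | a. a \<in> carrier R}"
  proof (intro subset_antisym subsetI)
    fix x assume "x \<in> {a \<odot>\<^bsub>M\<^esub> v | a. a \<in> carrier R}"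
    then obtain a where "a \<in> carrier R" "x = a \<odot>\<^bsub>M\<^esub> v" by auto
    then show "x \<in> {a v \<odot>\<^bsub>M\<^esub> v | a. a \<in> {v} \<rightarrow> carrier R}"
      by (intro CollectI exI[of _ "\<lambda>_. a"]) auto
  qed auto
  finally show ?thesis .
qed

lemma span_vec_singleton:
  fixes v :: "'a::field vec"
  assumes "v \<in> carrier_vec n"
  shows "span_vec n {v} = {c \<cdot>\<^sub>v v | c. True}"
proof -
  interpret module "class_ring :: 'a ring" "module_vec TYPE('a) n" by (rule vec_module)
  show ?thesis
    using span_singleton[of v] assms by (simp add: module_vec_simps class_ring_simps)
qed

lemma span_mat_singleton:
  fixes M :: "'a::field mat"
  assumes "M \<in> carrier_mat n n"
  shows "span_mat n {M} = {c \<cdot>\<^sub>m M | c. True}"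
proof -
  interpret vectorspace "class_ring :: 'a ring" "module_mat TYPE('a) n n" by (rule matrix_vs)
  show ?thesis
    using span_singleton[of M] assms by (simp add: module_mat_simps class_ring_simps)
qed

lemma eigenvector_smult:
  fixes M :: "'a::field mat"
  assumes M: "M \<in> carrier_mat n n" and ev: "eigenvector (c \<cdot>\<^sub>m M) (d \<cdot>\<^sub>v v) k"
    and v: "v \<in> carrier_vec n" and c: "c \<noteq> 0"
  shows "\<exists>k'. eigenvector M v k'"
proof -
  have d: "d \<noteq> 0" and v0: "v \<noteq> 0\<^sub>v n"
    using ev M v by (auto simp: eigenvector_def)
  have "(c \<cdot>\<^sub>m M) *\<^sub>v (d \<cdot>\<^sub>v v) = k \<cdot>\<^sub>v (d \<cdot>\<^sub>v v)"
    using ev by (simp add: eigenvector_def)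
  moreover have "(c \<cdot>\<^sub>m M) *\<^sub>v (d \<cdot>\<^sub>v v) = (c * d) \<cdot>\<^sub>v (M *\<^sub>v v)"
    using M v by (intro eq_vecI) (auto simp: scalar_prod_def sum_distrib_left mult_ac)
  ultimately have eq: "(c * d) \<cdot>\<^sub>v (M *\<^sub>v v) = (k * d) \<cdot>\<^sub>v v"
    by (simp add: smult_smult_assoc)
  have "M *\<^sub>v v = (inverse (c * d) * (c * d)) \<cdot>\<^sub>v (M *\<^sub>v v)"
  proof -
    have "inverse (c * d) * (c * d) = 1"
      using c d by (intro left_inverse) simp
    then show ?thesis by (simp only: one_smult_vec)
  qed
  also have "\<dots> = inverse (c * d) \<cdot>\<^sub>v ((k * d) \<cdot>\<^sub>v v)"
    unfolding eq[symmetric] by (simp add: smult_smult_assoc)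
  finally have "M *\<^sub>v v = (inverse (c * d) * (k * d)) \<cdot>\<^sub>v v"
    by (simp add: smult_smult_assoc)
  then show ?thesis
    using v v0 M by (auto simp: eigenvector_def)
qed

lemma SIG_adjacent_iff:
  fixes M :: "'a::field mat"
  assumes M: "M \<in> E_mats n" and v: "v \<in> carrier_vec n" "v \<noteq> 0\<^sub>v n"
  shows "(Inl (span_mat n {M}), Inr (span_vec n {v})) \<in> parcs (SIG n)
           \<longleftrightarrow> (\<exists>k. eigenvector M v k)"
proof
  assume "(Inl (span_mat n {M}), Inr (span_vec n {v})) \<in> parcs (SIG n)"
  then obtain N w k where N: "N \<in> E_mats n" and ev: "eigenvector N w k"
    and eq: "span_mat n {M} = span_mat n {N}" "span_vec n {v} = span_vec n {w}"
    by (auto simp: SIG_def SIG_edges_def)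
  have Mc: "M \<in> carrier_mat n n" and Nc: "N \<in> carrier_mat n n" and N0: "N \<noteq> 0\<^sub>m n n"
    using M N by (auto simp: E_mats_def)
  have wc: "w \<in> carrier_vec n" using ev Nc by (auto simp: eigenvector_def)
  have "N = 1 \<cdot>\<^sub>m N" "w = 1 \<cdot>\<^sub>v w" by auto
  then have "N \<in> span_mat n {N}" "w \<in> span_vec n {w}"
    unfolding span_mat_singleton[OF Nc] span_vec_singleton[OF wc] by blast+
  then obtain c d where cd: "N = c \<cdot>\<^sub>m M" "w = d \<cdot>\<^sub>v v"
    unfolding eq[symmetric] span_mat_singleton[OF Mc] span_vec_singleton[OF v(1)] by auto
  have "c \<noteq> 0" using cd N0 Mc by auto
  then show "\<exists>k. eigenvector M v k"
    using eigenvector_smult[OF Mc _ v(1)] ev cd by blast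
next
  assume "\<exists>k. eigenvector M v k"
  then show "(Inl (span_mat n {M}), Inr (span_vec n {v})) \<in> parcs (SIG n)"
    using M by (auto simp: SIG_def SIG_edges_def)
qed

lemma pair_graph_SIG: "pair_graph (SIG n :: 'a::{field,finite} sig_vertex pair_pre_digraph)"
proof -
  let ?G = "SIG n :: 'a sig_vertex pair_pre_digraph"
  have wf: "parcs ?G \<subseteq> pverts ?G \<times> pverts ?G"
    by (auto simp: SIG_def SIG_edges_def E_lines_def P_lines_def E_mats_def eigenvector_def)
  have "finite (carrier_mat n n :: 'a mat set)"
  proof -
    have "carrier_mat n n \<subseteq> (\<lambda>f. mat n n f) ` (({..<n} \<times> {..<n}) \<rightarrow>\<^sub>E (UNIV :: 'a set))"
    proof
      fix A :: "'a mat" assume "A \<in> carrier_mat n n"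
      then have "A = mat n n (restrict (($$) A) ({..<n} \<times> {..<n}))" by (intro eq_matI) auto
      then show "A \<in> (\<lambda>f. mat n n f) ` (({..<n} \<times> {..<n}) \<rightarrow>\<^sub>E (UNIV :: 'a set))"
        by (rule image_eqI[where x = "restrict (($$) A) ({..<n} \<times> {..<n})"]) auto
    qed
    then show ?thesis by (rule finite_subset) (simp add: finite_PiE)
  qed
  moreover have "finite (carrier_vec n :: 'a vec set)"
  proof -
    have "carrier_vec n \<subseteq> vec n ` ({..<n} \<rightarrow>\<^sub>E (UNIV :: 'a set))"
    proof
      fix v :: "'a vec" assume "v \<in> carrier_vec n"
      then have "v = vec n (restrict (($) v) {..<n})" by (intro eq_vecI) auto
      then show "v \<in> vec n ` ({..<n} \<rightarrow>\<^sub>E (UNIV :: 'a set))"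
        by (rule image_eqI[where x = "restrict (($) v) {..<n}"]) auto
    qed
    then show ?thesis by (rule finite_subset) (simp add: finite_PiE)
  qed
  ultimately have fin: "finite (pverts ?G)"
    by (auto simp: SIG_def E_lines_def P_lines_def E_mats_def)
  then have fin': "finite (parcs ?G)"
    using wf by (meson finite_SigmaI finite_subset)
  have "sym (parcs ?G)"
    by (auto simp: SIG_def sym_Un_converse)
  moreover have "fst e \<noteq> snd e" if "e \<in> parcs ?G" for e
    using that by (auto simp: SIG_def SIG_edges_def)
  ultimately show ?thesis
    using wf fin fin' by unfold_locales (auto simp: symmetric_def)
qed

end

theory Submission
  imports Defs
begin

text \<open>
  The vertex \<open>\<langle>1\<rangle>\<close> of the identity matrix is adjacent to every line of vectors, and every line of
  matrices is adjacent to some line of vectors; so the graph is connected, and an automorphism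
  either preserves or exchanges the two classes of the bipartition. The exchange cannot happen:
  \<open>\<langle>1\<rangle>\<close> would go to a line \<open>\<langle>v\<rangle>\<close> that is adjacent to all lines of matrices, yet for \<open>n \<ge> 2\<close> every
  \<open>v \<noteq> 0\<close> is moved off its own line by some matrix unit, which has eigenvectors of its own
  (\<open>not_eigenvector_of_all_E_mats\<close>). The combinatorial half of this argument is
  \<open>bipartite_automorphism_preserves_classes\<close>.
\<close>

text \<open>
  The image of the dominating vertex \<open>c\<close> decides which of the two cases holds: all of \<open>B\<close>
  consists of neighbours of \<open>c\<close>, so \<open>\<phi>\<close> maps \<open>B\<close> into the class opposite to that of \<open>\<phi> c\<close>, and
  then \<open>A\<close>, all of whose elements have neighbours in \<open>B\<close>, into the same class as \<open>\<phi> c\<close>. In the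
  exchanging case \<open>\<phi> c\<close> would be adjacent to all of \<open>A\<close>.
\<close>

lemma bipartite_automorphism_preserves_classes:
  fixes A B :: "'a set"
  assumes perm: "\<phi> permutes (A \<union> B)" and disj: "A \<inter> B = {}"
    and bip: "R \<subseteq> A \<times> B \<union> B \<times> A"
    and hom: "\<And>x y. (x, y) \<in> R \<Longrightarrow> (\<phi> x, \<phi> y) \<in> R"
    and c: "c \<in> A" "\<And>b. b \<in> B \<Longrightarrow> (c, b) \<in> R"
    and nbr: "\<And>a. a \<in> A \<Longrightarrow> \<exists>b\<in>B. (a, b) \<in> R"
    and not_dom: "\<And>b. b \<in> B \<Longrightarrow> \<exists>a\<in>A. (b, a) \<notin> R"
  shows "\<phi> ` A = A \<and> \<phi> ` B = B"
proof -
  have im: "\<phi> ` A \<union> \<phi> ` B = A \<union> B"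
    using permutes_image[OF perm] by (simp add: image_Un)
  have split: "X = S \<and> Y = T"
    if "X \<subseteq> S" "Y \<subseteq> T" "X \<union> Y = S \<union> T" "S \<inter> T = {}" for X Y S T :: "'a set"
    using that by blast
  have opp: "y \<in> B" if "(x, y) \<in> R" "x \<in> A" for x y
    using that bip disj by blast
  have opp': "y \<in> A" if "(x, y) \<in> R" "x \<in> B" for x y
    using that bip disj by blast
  have "\<phi> c \<in> A \<union> B" using im c(1) by blast
  then show ?thesis
  proof
    assume "\<phi> c \<in> A"
    then have B: "\<phi> ` B \<subseteq> B" using c(2) hom opp by blast
    have "\<phi> ` A \<subseteq> A"
    proof
      fix x assume "x \<in> \<phi> ` A"
      then obtain a b where "x = \<phi> a" "b \<in> B" "(a, b) \<in> R" using nbr by blast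
      then show "x \<in> A" using B hom[of a b] bip disj by blast
    qed
    then show ?thesis using split B im disj by metis
  next
    assume cB: "\<phi> c \<in> B"
    then have B: "\<phi> ` B \<subseteq> A" using c(2) hom opp' by blast
    have "\<phi> ` A \<subseteq> B"
    proof
      fix x assume "x \<in> \<phi> ` A"
      then obtain a b where "x = \<phi> a" "b \<in> B" "(a, b) \<in> R" using nbr by blast
      then show "x \<in> B" using B hom[of a b] bip disj by blast
    qed
    then have "\<phi> ` B = A" using split[of "\<phi> ` B" A "\<phi> ` A" B] B im disj by (simp add: Un_commute)
    then have "(\<phi> c, a) \<in> R" if "a \<in> A" for a
      using that c(2) hom by blast
    with not_dom[OF cB] show ?thesis by blast
  qed
qed

lemma eigenvector_one_mat:
  fixes v :: "'a::field vec"
  assumes "v \<in> carrier_vec n" "v \<noteq> 0\<^sub>v n"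
  shows "eigenvector (1\<^sub>m n) v 1"
  using assms by (simp add: eigenvector_def)

lemma one_mat_in_E_mats:
  assumes "n > 0"
  shows "(1\<^sub>m n :: 'a::field mat) \<in> E_mats n"
proof -
  have "(unit_vec n 0 :: 'a vec) \<noteq> 0\<^sub>v n"
    using assms by (rule unit_vec_nonzero)
  then have "eigenvector (1\<^sub>m n :: 'a mat) (unit_vec n 0) 1"
    by (intro eigenvector_one_mat) auto
  moreover have "(1\<^sub>m n :: 'a mat) \<noteq> 0\<^sub>m n n"
  proof
    assume "(1\<^sub>m n :: 'a mat) = 0\<^sub>m n n"
    then have "(1\<^sub>m n :: 'a mat) $$ (0, 0) = 0\<^sub>m n n $$ (0, 0)" by simp
    with assms show False by simp
  qed
  ultimately show ?thesis by (auto simp: E_mats_def)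
qed

text \<open>
  If the \<open>i\<close>-th coordinate of \<open>v\<close> is nonzero, then for any \<open>j \<noteq> i\<close> the matrix unit \<open>e\<^sub>j e\<^sub>i\<^sup>T\<close> takes
  \<open>v\<close> to a nonzero multiple of \<open>e\<^sub>j\<close>, which is not a multiple of \<open>v\<close>; but it annihilates \<open>e\<^sub>j\<close> and so
  has an eigenvector.
\<close>

lemma not_eigenvector_of_all_E_mats:
  fixes v :: "'a::field vec"
  assumes n: "n \<ge> 2" and v: "v \<in> carrier_vec n" "v \<noteq> 0\<^sub>v n"
  shows "\<exists>M\<in>E_mats n. \<nexists>k. eigenvector M v k"
proof -
  obtain i where i: "i < n" "v $ i \<noteq> 0"
    using v by (metis carrier_vecD eq_vecI index_zero_vec)
  define j :: nat where "j = (if i = 0 then 1 else 0)"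
  have j: "j < n" "j \<noteq> i" using n by (auto simp: j_def)
  define M :: "'a mat" where "M = mat n n (\<lambda>(r, s). if r = j \<and> s = i then 1 else 0)"
  have Mc: "M \<in> carrier_mat n n" by (simp add: M_def)
  have Mw: "(M *\<^sub>v w) $ r = (if r = j then w $ i else 0)" if "w \<in> carrier_vec n" "r < n" for w r
  proof -
    have "(M *\<^sub>v w) $ r = (\<Sum>s<n. (if r = j \<and> s = i then 1 else 0) * w $ s)"
      using that by (simp add: M_def scalar_prod_def atLeast0LessThan)
    also have "\<dots> = (\<Sum>s<n. if s = i then (if r = j then w $ i else 0) else 0)"
      by (intro sum.cong) auto
    also have "\<dots> = (if r = j then w $ i else 0)"
      using i(1) by simp
    finally show ?thesis .
  qed
  have "M *\<^sub>v unit_vec n j = 0 \<cdot>\<^sub>v unit_vec n j"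
    using Mc i j by (intro eq_vecI) (auto simp: M_def)
  then have "eigenvector M (unit_vec n j) 0"
    using Mc j by (simp add: eigenvector_def unit_vec_nonzero)
  moreover have "M \<noteq> 0\<^sub>m n n"
  proof
    assume "M = 0\<^sub>m n n"
    then have "M $$ (j, i) = 0\<^sub>m n n $$ (j, i)" by simp
    with i j show False by (simp add: M_def)
  qed
  ultimately have "M \<in> E_mats n" using Mc by (auto simp: E_mats_def)
  moreover have "\<not> eigenvector M v k" for k
  proof
    assume "eigenvector M v k"
    then have eq: "M *\<^sub>v v = k \<cdot>\<^sub>v v" by (simp add: eigenvector_def)
    \<comment> \<open>Coordinate \<open>i\<close> forces \<open>k = 0\<close>, which coordinate \<open>j\<close> contradicts.\<close>
    have "k * v $ i = 0" using Mw[OF v(1) i(1)] i j v by (simp add: eq)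
    moreover have "k * v $ j = v $ i" using Mw[OF v(1) j(1)] j v by (simp add: eq)
    ultimately show False using i by auto
  qed
  ultimately show ?thesis by blast
qed

theorem lemma3p1:
  fixes n :: nat
    and \<phi> :: "'a::{field,finite} sig_vertex \<Rightarrow> 'a sig_vertex"
  assumes "n \<ge> 2"
    and "\<phi> \<in> graph_Aut (SIG n)"
  shows "\<phi> ` (Inl ` E_lines n) = Inl ` E_lines n \<and>
         \<phi> ` (Inr ` P_lines n) = Inr ` P_lines n"
proof (rule bipartite_automorphism_preserves_classes)
  let ?G = "SIG n :: 'a sig_vertex pair_pre_digraph"
  let ?E = "Inl ` E_lines n :: 'a sig_vertex set" and ?P = "Inr ` P_lines n :: 'a sig_vertex set"
  have verts: "pverts ?G = ?E \<union> ?P" by (simp add: SIG_def Plus_def)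
  show "\<phi> permutes (?E \<union> ?P)"
    using assms(2) by (simp add: graph_Aut_def verts)
  show "?E \<inter> ?P = {}" by auto
  show bip: "parcs ?G \<subseteq> ?E \<times> ?P \<union> ?P \<times> ?E"
  proof -
    have "SIG_edges n \<subseteq> ?E \<times> ?P"
    proof
      fix e :: "'a sig_vertex \<times> 'a sig_vertex" assume "e \<in> SIG_edges n"
      then obtain M v k where M: "M \<in> E_mats n" and ev: "eigenvector M v k"
        and e: "e = (Inl (span_mat n {M}), Inr (span_vec n {v}))"
        unfolding SIG_edges_def by blast
      have "v \<in> carrier_vec n" "v \<noteq> 0\<^sub>v n"
        using M ev by (auto simp: E_mats_def eigenvector_def)
      then have "span_vec n {v} \<in> P_lines n" unfolding P_lines_def by blast
      moreover have "span_mat n {M} \<in> E_lines n" unfolding E_lines_def using M by blast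
      ultimately show "e \<in> ?E \<times> ?P" by (simp add: e)
    qed
    then have "SIG_edges n \<union> (SIG_edges n)\<inverse> \<subseteq> ?E \<times> ?P \<union> ?P \<times> ?E" by blast
    then show ?thesis by (simp add: SIG_def)
  qed
  show "(\<phi> x, \<phi> y) \<in> parcs ?G" if "(x, y) \<in> parcs ?G" for x y
  proof -
    have "x \<in> pverts ?G" "y \<in> pverts ?G" using that bip verts by auto
    with that assms(2) show ?thesis by (auto simp: graph_Aut_def)
  qed
  have one: "(1\<^sub>m n :: 'a mat) \<in> E_mats n" using assms(1) by (intro one_mat_in_E_mats) simp
  then show "Inl (span_mat n {1\<^sub>m n}) \<in> ?E" by (auto simp: E_lines_def)
  show "(Inl (span_mat n {1\<^sub>m n}), b) \<in> parcs ?G" if "b \<in> ?P" for b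
  proof -
    from that obtain v where v: "v \<in> carrier_vec n" "v \<noteq> 0\<^sub>v n" and b: "b = Inr (span_vec n {v})"
      by (auto simp: P_lines_def)
    show ?thesis
      unfolding b SIG_adjacent_iff[OF one v] using eigenvector_one_mat[OF v] by blast
  qed
  show "\<exists>b\<in>?P. (a, b) \<in> parcs ?G" if "a \<in> ?E" for a
  proof -
    from that obtain M where M: "M \<in> E_mats n" "a = Inl (span_mat n {M})"
      unfolding E_lines_def by blast
    then obtain v k where ev: "eigenvector M v k" unfolding E_mats_def by blast
    with M have v: "v \<in> carrier_vec n" "v \<noteq> 0\<^sub>v n"
      by (auto simp: E_mats_def eigenvector_def)
    then have "Inr (span_vec n {v}) \<in> ?P" by (auto simp: P_lines_def)
    moreover have "(a, Inr (span_vec n {v})) \<in> parcs ?G"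
      unfolding M(2) SIG_adjacent_iff[OF M(1) v] using ev by blast
    ultimately show ?thesis by blast
  qed
  show "\<exists>a\<in>?E. (b, a) \<notin> parcs ?G" if "b \<in> ?P" for b
  proof -
    from that obtain v where v: "v \<in> carrier_vec n" "v \<noteq> 0\<^sub>v n" and b: "b = Inr (span_vec n {v})"
      by (auto simp: P_lines_def)
    obtain M where M: "M \<in> E_mats n" "\<nexists>k. eigenvector M v k"
      using not_eigenvector_of_all_E_mats[OF assms(1) v] by blast
    have "(Inl (span_mat n {M}), b) \<notin> parcs ?G"
      unfolding b SIG_adjacent_iff[OF M(1) v] using M(2) .
    then have "(b, Inl (span_mat n {M})) \<notin> parcs ?G" by (auto simp: SIG_def)
    moreover have "Inl (span_mat n {M}) \<in> ?E" using M(1) by (auto simp: E_lines_def)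
    ultimately show ?thesis by blast
  qed
qed

end
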